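(* Let $I,J\ge1$, let $t_i,s_{ij},K_{ij}$ $(i\in[I],j\in[J])$ be positive integers, let $\mathcal U=\{(i,j,r): i\in[I], j\in[J], r\in[K_{ij}]\}$, and let $c_{ijr}$, $(i,j,r)\in\mathcal U$, be positive integers. Consider the linear program (the OPA model) $$\max_{\mathbf w,z}\ z\quad\text{s.t. }\Big(\sum_{h=r}^{K_{ij}}\tfrac1h\Big)z\le t_is_{ij}w_{ijr}\ \ \forall(i,j,r)\in\mathcal U,\qquad \sum_{i=1}^I\sum_{j=1}^J\sum_{r=1}^{K_{ij}}c_{ijr}w_{ijr}=1,\qquad w_{ijr}\ge0\ \ \forall(i,j,r)\in\mathcal U.$$ Then its optimal solution is $$z^*=1\Bigg/\sum_{i=1}^I\sum_{j=1}^J\sum_{r=1}^{K_{ij}}\frac{c_{ijr}\sum_{h=r}^{K_{ij}}\frac1h}{t_is_{ij}}$$ and $$w^*_{ijr}=\Big(\sum_{h=r}^{K_{ij}}\tfrac1h\Big)\Bigg/\Bigg(t_is_{ij}\sum_{i'=1}^I\sum_{j'=1}^J\sum_{r'=1}^{K_{i'j'}}\frac{c_{i'j'r'}\sum_{h=r'}^{K_{i'j'}}\frac1h}{t_{i'}s_{i'j'}}\Bigg),\qquad\forall(i,j,r)\in\mathcal U.$$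
   Context: $[n]=\{1,\dots,n\}$. Here $t_i$ is the rank of expert $i$, $s_{ij}$ the rank expert $i$ gives attribute $j$, $K_{ij}$ the largest rank expert $i$ uses for alternatives under attribute $j$, and $c_{ijr}$ the number of alternatives given rank $r$ by expert $i$ under attribute $j$ (duplicate ranks allowed; all consecutive ranks $1,\dots,K_{ij}$ occur). The variable $w_{ijr}$ is the weight of an alternative ranked $r$ under expert $i$ and attribute $j$; $z\in\mathbb R$. *)

theory Defs
  imports Complex_Main
begin

definition opa_index :: "nat \<Rightarrow> nat \<Rightarrow> (nat \<Rightarrow> nat \<Rightarrow> nat) \<Rightarrow> (nat \<times> nat \<times> nat) set" where
  "opa_index I J K = {(i, j, r). i \<in> {1..I} \<and> j \<in> {1..J} \<and> r \<in> {1..K i j}}"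

text \<open>The weights are the values of \<open>w\<close> on \<open>opa_index I J K\<close>; values of \<open>w\<close> (and of
  the data \<open>t\<close>, \<open>s\<close>, \<open>K\<close>, \<open>c\<close>) at other arguments are never used.\<close>

definition opa_feasible ::
  "nat \<Rightarrow> nat \<Rightarrow> (nat \<Rightarrow> nat) \<Rightarrow> (nat \<Rightarrow> nat \<Rightarrow> nat) \<Rightarrow> (nat \<Rightarrow> nat \<Rightarrow> nat) \<Rightarrow>
   (nat \<Rightarrow> nat \<Rightarrow> nat \<Rightarrow> nat) \<Rightarrow> (nat \<Rightarrow> nat \<Rightarrow> nat \<Rightarrow> real) \<Rightarrow> real \<Rightarrow> bool" where
  "opa_feasible I J t s K c w z \<longleftrightarrow>
     (\<forall>(i, j, r) \<in> opa_index I J K.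
        (\<Sum>h=r..K i j. 1 / real h) * z \<le> real (t i) * real (s i j) * w i j r) \<and>
     (\<Sum>i=1..I. \<Sum>j=1..J. \<Sum>r=1..K i j. real (c i j r) * w i j r) = 1 \<and>
     (\<forall>(i, j, r) \<in> opa_index I J K. 0 \<le> w i j r)"

definition opa_optimal ::
  "nat \<Rightarrow> nat \<Rightarrow> (nat \<Rightarrow> nat) \<Rightarrow> (nat \<Rightarrow> nat \<Rightarrow> nat) \<Rightarrow> (nat \<Rightarrow> nat \<Rightarrow> nat) \<Rightarrow>
   (nat \<Rightarrow> nat \<Rightarrow> nat \<Rightarrow> nat) \<Rightarrow> (nat \<Rightarrow> nat \<Rightarrow> nat \<Rightarrow> real) \<Rightarrow> real \<Rightarrow> bool" where
  "opa_optimal I J t s K c w z \<longleftrightarrow>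
     opa_feasible I J t s K c w z \<and>
     (\<forall>w' z'. opa_feasible I J t s K c w' z' \<longrightarrow> z' \<le> z)"

end

theory Submission
  imports Defs
begin

text \<open>Dividing by \<open>t\<^sub>i s\<^sub>i\<^sub>j\<close>, the ranking constraints become lower bounds \<open>a\<^sub>u z \<le> w\<^sub>u\<close> with
  \<open>a\<^sub>u > 0\<close>. Averaging them with the weights \<open>c\<^sub>u > 0\<close> and using the normalisation gives
  \<open>(\<Sum>u. c\<^sub>u a\<^sub>u) z \<le> 1\<close>. This bound is attained, and since all \<open>c\<^sub>u\<close> are positive, equality
  forces every constraint to be tight, which determines \<open>w\<close>.\<close>

text \<open>The program with the factor \<open>t i * s i j\<close> divided out and the triple
  \<open>(i, j, r)\<close> flattened to one index \<open>u\<close>, so that the argument needs only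
  single sums over an arbitrary index set.\<close>

definition ratio_feasible ::
  "'u set \<Rightarrow> ('u \<Rightarrow> real) \<Rightarrow> ('u \<Rightarrow> real) \<Rightarrow> ('u \<Rightarrow> real) \<Rightarrow> real \<Rightarrow> bool" where
  "ratio_feasible U a c w z \<longleftrightarrow>
     (\<forall>u\<in>U. a u * z \<le> w u) \<and> (\<Sum>u\<in>U. c u * w u) = 1 \<and> (\<forall>u\<in>U. 0 \<le> w u)"

lemma ratio_feasible_bound:
  assumes c: "\<And>u. u \<in> U \<Longrightarrow> 0 < c u" and feas: "ratio_feasible U a c w z"
  shows "(\<Sum>u\<in>U. c u * a u) * z \<le> 1"
proof -
  have "(\<Sum>u\<in>U. c u * a u) * z = (\<Sum>u\<in>U. c u * (a u * z))"
    by (simp add: sum_distrib_right mult.assoc)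
  also have "\<dots> \<le> (\<Sum>u\<in>U. c u * w u)"
    using feas c by (intro sum_mono mult_left_mono) (auto simp: ratio_feasible_def less_imp_le)
  finally show ?thesis
    using feas by (simp add: ratio_feasible_def)
qed

text \<open>The weighted slacks \<open>c u * (w u - a u * z)\<close> are nonnegative and sum to 1 -
  1 = 0, so each one vanishes; since \<open>c u\<close> is positive, the slack itself is
  zero.\<close>

lemma ratio_feasible_tight:
  assumes "finite U" and c: "\<And>u. u \<in> U \<Longrightarrow> 0 < c u"
    and feas: "ratio_feasible U a c w z" and eq: "(\<Sum>u\<in>U. c u * a u) * z = 1" and "u \<in> U"
  shows "w u = a u * z"
proof -
  have "(\<Sum>u\<in>U. c u * (w u - a u * z)) = (\<Sum>u\<in>U. c u * w u) - (\<Sum>u\<in>U. c u * a u) * z"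
    by (simp add: right_diff_distrib sum_subtractf sum_distrib_right mult.assoc)
  also have "\<dots> = 0"
    using feas eq by (simp add: ratio_feasible_def)
  finally have "\<forall>u\<in>U. c u * (w u - a u * z) = 0"
    using \<open>finite U\<close> c feas
    by (subst (asm) sum_nonneg_eq_0_iff) (auto simp: ratio_feasible_def less_imp_le)
  then show ?thesis
    using c \<open>u \<in> U\<close> by fastforce
qed

text \<open>Being an equivalence, this gives existence and uniqueness of the optimum together: the
  right-to-left direction is optimality of the closed form, the other direction is
  uniqueness.\<close>

lemma ratio_optimal_iff:
  assumes "finite U" and "U \<noteq> {}"
    and a: "\<And>u. u \<in> U \<Longrightarrow> 0 < a u" and c: "\<And>u. u \<in> U \<Longrightarrow> 0 < c u"
  defines "D \<equiv> \<Sum>u\<in>U. c u * a u"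
  shows "(ratio_feasible U a c w z \<and> (\<forall>w' z'. ratio_feasible U a c w' z' \<longrightarrow> z' \<le> z)) \<longleftrightarrow>
    z = 1 / D \<and> (\<forall>u\<in>U. w u = a u / D)"
proof -
  \<comment> \<open>Nonemptiness of \<open>U\<close> enters here: an empty sum would make
    \<open>D\<close> zero.\<close>
  have D: "0 < D"
    unfolding D_def using assms by (intro sum_pos) auto
  \<comment> \<open>Stated for every \<open>v\<close> agreeing with the formula on \<open>U\<close>,
    since values outside \<open>U\<close> are unconstrained. It then covers both the explicit
    witness and the given \<open>w\<close>.\<close>
  have feas: "ratio_feasible U a c v (1 / D)" if "\<forall>u\<in>U. v u = a u / D" for v
  proof -
    have "(\<Sum>u\<in>U. c u * v u) = (\<Sum>u\<in>U. c u * a u) / D"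
      unfolding sum_divide_distrib using that by (intro sum.cong) auto
    then have "(\<Sum>u\<in>U. c u * v u) = 1"
      using D by (simp flip: D_def)
    then show ?thesis
      using that D a by (auto simp: ratio_feasible_def less_imp_le)
  qed
  have bound: "z' \<le> 1 / D" if "ratio_feasible U a c w' z'" for w' z'
    using ratio_feasible_bound[OF c that] D by (simp add: D_def field_simps)
  show ?thesis
  proof (intro iffI)
    assume opt: "ratio_feasible U a c w z \<and> (\<forall>w' z'. ratio_feasible U a c w' z' \<longrightarrow> z' \<le> z)"
    \<comment> \<open>This competitor forces an optimal \<open>z\<close> to be at least
      \<open>1 / D\<close>; \<open>bound\<close> gives the reverse inequality.\<close>
    have "ratio_feasible U a c (\<lambda>u. a u / D) (1 / D)"
      by (rule feas) simp
    then have z: "z = 1 / D"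
      using opt bound by (meson order_antisym)
    have "w u = a u / D" if "u \<in> U" for u
      using ratio_feasible_tight[of U c a w z u] assms(1) c opt that z D
      by (simp add: D_def)
    then show "z = 1 / D \<and> (\<forall>u\<in>U. w u = a u / D)"
      using z by blast
  next
    assume "z = 1 / D \<and> (\<forall>u\<in>U. w u = a u / D)"
    then show "ratio_feasible U a c w z \<and> (\<forall>w' z'. ratio_feasible U a c w' z' \<longrightarrow> z' \<le> z)"
      using feas bound by blast
  qed
qed

text \<open>The dependent-sum form mirrors the nesting of the triple sums, whose innermost range
  depends on \<open>i\<close> and \<open>j\<close>.\<close>

lemma opa_index_Sigma: "opa_index I J K = (SIGMA i:{1..I}. SIGMA j:{1..J}. {1..K i j})"
  by (auto simp: opa_index_def)

lemma finite_opa_index: "finite (opa_index I J K)"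
  by (simp add: opa_index_Sigma)

lemma opa_index_nonempty:
  assumes "1 \<le> I" and "1 \<le> J" and "0 < K 1 1"
  shows "opa_index I J K \<noteq> {}"
proof -
  have "(1, 1, 1) \<in> opa_index I J K"
    using assms by (simp add: opa_index_def)
  then show ?thesis by blast
qed

lemma sum_opa_index:
  "(\<Sum>i=1..I. \<Sum>j=1..J. \<Sum>r=1..K i j. f i j r) = (\<Sum>(i, j, r)\<in>opa_index I J K. f i j r)"
  unfolding opa_index_Sigma by (simp add: sum.Sigma)

text \<open>The range is nonempty because \<open>r \<le> k\<close>, and \<open>1 \<le> r\<close>
  keeps \<open>h\<close> away from 0, where \<open>1 / real h\<close> would be 0.\<close>

lemma harmonic_tail_pos:
  assumes "1 \<le> r" and "r \<le> (k::nat)"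
  shows "0 < (\<Sum>h=r..k. 1 / real h)"
  using assms by (intro sum_pos) auto

lemma opa_feasible_iff_ratio_feasible:
  assumes "\<forall>i \<in> {1..I}. 0 < t i" and "\<forall>i \<in> {1..I}. \<forall>j \<in> {1..J}. 0 < s i j"
  shows "opa_feasible I J t s K c w z \<longleftrightarrow>
    ratio_feasible (opa_index I J K)
      (\<lambda>(i, j, r). (\<Sum>h=r..K i j. 1 / real h) / (real (t i) * real (s i j)))
      (\<lambda>(i, j, r). real (c i j r)) (\<lambda>(i, j, r). w i j r) z"
proof -
  have "(\<Sum>h=r..K i j. 1 / real h) * z \<le> real (t i) * real (s i j) * w i j r \<longleftrightarrow>
      (\<Sum>h=r..K i j. 1 / real h) / (real (t i) * real (s i j)) * z \<le> w i j r"
    if "(i, j, r) \<in> opa_index I J K" for i j r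
  proof -
    have "0 < real (t i) * real (s i j)"
      using assms that by (auto simp: opa_index_def)
    then show ?thesis
      by (simp add: pos_divide_le_eq mult.commute)
  qed
  then show ?thesis
    unfolding opa_feasible_def ratio_feasible_def sum_opa_index
    by (auto simp: case_prod_beta)
qed

theorem theorem2:
  fixes I J :: nat
    and t :: "nat \<Rightarrow> nat"
    and s K :: "nat \<Rightarrow> nat \<Rightarrow> nat"
    and c :: "nat \<Rightarrow> nat \<Rightarrow> nat \<Rightarrow> nat"
  assumes "1 \<le> I" and "1 \<le> J"
    and "\<forall>i \<in> {1..I}. 0 < t i"
    and "\<forall>i \<in> {1..I}. \<forall>j \<in> {1..J}. 0 < s i j"
    and "\<forall>i \<in> {1..I}. \<forall>j \<in> {1..J}. 0 < K i j"
    and "\<forall>(i, j, r) \<in> opa_index I J K. 0 < c i j r"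
  shows "\<forall>(w :: nat \<Rightarrow> nat \<Rightarrow> nat \<Rightarrow> real) (z :: real).
    opa_optimal I J t s K c w z \<longleftrightarrow>
      z = 1 / (\<Sum>i=1..I. \<Sum>j=1..J. \<Sum>r=1..K i j.
                 real (c i j r) * (\<Sum>h=r..K i j. 1 / real h) / (real (t i) * real (s i j))) \<and>
      (\<forall>(i, j, r) \<in> opa_index I J K.
         w i j r = (\<Sum>h=r..K i j. 1 / real h) /
           (real (t i) * real (s i j) *
            (\<Sum>i'=1..I. \<Sum>j'=1..J. \<Sum>r'=1..K i' j'.
               real (c i' j' r') * (\<Sum>h=r'..K i' j'. 1 / real h) /
                 (real (t i') * real (s i' j')))))"
proof (intro allI)
  fix w :: "nat \<Rightarrow> nat \<Rightarrow> nat \<Rightarrow> real" and z :: real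
  let ?U = "opa_index I J K"
  let ?a = "\<lambda>(i, j, r). (\<Sum>h=r..K i j. 1 / real h) / (real (t i) * real (s i j))"
  let ?c = "\<lambda>(i, j, r). real (c i j r)"
  let ?w = "\<lambda>(i, j, r). w i j r"
  define D where "D = (\<Sum>i=1..I. \<Sum>j=1..J. \<Sum>r=1..K i j.
    real (c i j r) * (\<Sum>h=r..K i j. 1 / real h) / (real (t i) * real (s i j)))"
  have D: "D = (\<Sum>u\<in>?U. ?c u * ?a u)"
    unfolding D_def sum_opa_index by (intro sum.cong) auto
  have a: "0 < ?a u" if "u \<in> ?U" for u
    using that assms(3,4) harmonic_tail_pos by (auto simp: opa_index_def)
  have c: "0 < ?c u" if "u \<in> ?U" for u
    using that assms(6) by auto
  have nonempty: "?U \<noteq> {}"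
    using assms(1,2,5) by (intro opa_index_nonempty) auto
  \<comment> \<open>Optimality quantifies over all competitors, so feasibility must be transferred
    in both directions: each function \<open>v\<close> on triples is the uncurried form of some
    weight function, and conversely.\<close>
  have all_curried: "(\<forall>w' z'. opa_feasible I J t s K c w' z' \<longrightarrow> z' \<le> z) \<longleftrightarrow>
      (\<forall>v z'. ratio_feasible ?U ?a ?c v z' \<longrightarrow> z' \<le> z)"
  proof -
    have "ratio_feasible ?U ?a ?c v z' \<longleftrightarrow> opa_feasible I J t s K c (\<lambda>i j r. v (i, j, r)) z'"
      for v z'
      by (simp add: opa_feasible_iff_ratio_feasible[OF assms(3,4)])
    then show ?thesis
      using opa_feasible_iff_ratio_feasible[OF assms(3,4)] by blast
  qed
  have "opa_optimal I J t s K c w z \<longleftrightarrow> z = 1 / D \<and> (\<forall>u\<in>?U. ?w u = ?a u / D)"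
    unfolding opa_optimal_def all_curried D
      opa_feasible_iff_ratio_feasible[OF assms(3,4), of K c w z]
    by (rule ratio_optimal_iff[OF finite_opa_index nonempty a c])
  also have "\<dots> \<longleftrightarrow> z = 1 / D \<and> (\<forall>(i, j, r) \<in> ?U.
      w i j r = (\<Sum>h=r..K i j. 1 / real h) / (real (t i) * real (s i j) * D))"
    by (simp add: case_prod_beta)
  finally show "opa_optimal I J t s K c w z \<longleftrightarrow>
      z = 1 / (\<Sum>i=1..I. \<Sum>j=1..J. \<Sum>r=1..K i j.
                 real (c i j r) * (\<Sum>h=r..K i j. 1 / real h) / (real (t i) * real (s i j))) \<and>
      (\<forall>(i, j, r) \<in> opa_index I J K.
         w i j r = (\<Sum>h=r..K i j. 1 / real h) /
           (real (t i) * real (s i j) *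
            (\<Sum>i'=1..I. \<Sum>j'=1..J. \<Sum>r'=1..K i' j'.
               real (c i' j' r') * (\<Sum>h=r'..K i' j'. 1 / real h) /
                 (real (t i') * real (s i' j')))))"
    unfolding D_def .
qed

end
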